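(* Let $F\subset\mathbb{R}^2$ be a self-similar fractal necklace with a necklace iterated function system $\{f_1,\dots,f_n\}$ of similitudes of $\mathbb{R}^2$. If $F$ is stable, then $F$ has no cut points.
   Context: Let $I=\{1,2,\dots,n\}$. For $k\in I$ let $f_k:\mathbb{R}^2\to\mathbb{R}^2$ be contractive, i.e. $|f_k(x)-f_k(y)|\le c_k|x-y|$ for all $x,y$, with some $c_k\in(0,1)$. The attractor of the iterated function system (IFS) $\{f_1,\dots,f_n\}$ is the unique nonempty compact set $F\subset\mathbb{R}^2$ with $F=\bigcup_{k=1}^n f_k(F)$. Fractal necklace: $F$ is called a (fractal) necklace, and the ordered family $\{f_1,\dots,f_n\}$ a necklace IFS, if $n\ge3$, every $f_k$ is a contractive homeomorphism of $\mathbb{R}^2$ onto itself, and for each pair of distinct $m,k\in I$: $f_m(F)\cap f_k(F)$ is a singleton if $|m-k|=1$ or $|m-k|=n-1$, and $f_m(F)\cap f_k(F)=\emptyset$ if $2\le|m-k|\le n-2$. The necklace is self-similar if every $f_k$ is a similitude, i.e. $|f_k(x)-f_k(y)|=c_k|x-y|$ for all $x,y$ with some $c_k\in(0,1)$. Notation: $F_k=f_k(F)$ and $F_{kj}=f_k(f_j(F))$ for $k,j\in I$; $\partial_F A$ is the boundary of $A\subset F$ in the relative topology of $F$. Stable: $F$ is stable if for each $k\in I$ the set of sets $\{F_{kj}: j\in I,\ F_{kj}\cap\partial_F F_k\ne\emptyset\}$ has at least $2$ elements. Cut point: a point $x$ of a connected topological space $X$ is a cut point of $X$ if $X\setminus\{x\}$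 is not connected. (Every fractal necklace is connected.) *)

theory Defs
  imports "HOL-Analysis.Analysis"
begin

text \<open>An iterated function system is a family \<open>f\<close> of which only the members
  \<open>f 1, \<dots>, f n\<close> are relevant.\<close>

definition contractive :: "('a::metric_space \<Rightarrow> 'a) \<Rightarrow> bool" where
  "contractive g \<longleftrightarrow> (\<exists>c\<in>{0<..<1}. \<forall>x y. dist (g x) (g y) \<le> c * dist x y)"

definition similitude :: "('a::metric_space \<Rightarrow> 'a) \<Rightarrow> bool" where
  "similitude g \<longleftrightarrow> (\<exists>c\<in>{0<..<1}. \<forall>x y. dist (g x) (g y) = c * dist x y)"

text \<open>For contractive \<open>f 1, \<dots>, f n\<close> with \<open>n \<ge> 1\<close> on a complete space, exactly one set \<open>F\<close>
  satisfies this predicate.\<close>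

definition attractor :: "nat \<Rightarrow> (nat \<Rightarrow> 'a::metric_space \<Rightarrow> 'a) \<Rightarrow> 'a set \<Rightarrow> bool" where
  "attractor n f F \<longleftrightarrow> F \<noteq> {} \<and> compact F \<and> F = (\<Union>k\<in>{1..n}. f k ` F)"

definition necklace :: "nat \<Rightarrow> (nat \<Rightarrow> real^2 \<Rightarrow> real^2) \<Rightarrow> (real^2) set \<Rightarrow> bool" where
  "necklace n f F \<longleftrightarrow>
     n \<ge> 3 \<and>
     (\<forall>k\<in>{1..n}. contractive (f k) \<and> (\<exists>g. homeomorphism UNIV UNIV (f k) g)) \<and>
     attractor n f F \<and>
     (\<forall>m\<in>{1..n}. \<forall>k\<in>{1..n}. m \<noteq> k \<longrightarrow>
        (\<bar>int m - int k\<bar> = 1 \<or> \<bar>int m - int k\<bar> = int n - 1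
           \<longrightarrow> is_singleton (f m ` F \<inter> f k ` F)) \<and>
        (2 \<le> \<bar>int m - int k\<bar> \<and> \<bar>int m - int k\<bar> \<le> int n - 2
           \<longrightarrow> f m ` F \<inter> f k ` F = {}))"

definition self_similar_necklace ::
    "nat \<Rightarrow> (nat \<Rightarrow> real^2 \<Rightarrow> real^2) \<Rightarrow> (real^2) set \<Rightarrow> bool" where
  "self_similar_necklace n f F \<longleftrightarrow> necklace n f F \<and> (\<forall>k\<in>{1..n}. similitude (f k))"

text \<open>What is counted is the number of distinct sets \<open>f k ` f j ` F\<close>, not of indices \<open>j\<close>;
  the boundary is taken in the subspace \<open>F\<close>, not in the plane.\<close>

definition stable_necklace :: "nat \<Rightarrow> (nat \<Rightarrow> real^2 \<Rightarrow> real^2) \<Rightarrow> (real^2) set \<Rightarrow> bool" where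
  "stable_necklace n f F \<longleftrightarrow>
     (\<forall>k\<in>{1..n}.
        card {f k ` f j ` F | j.
                j \<in> {1..n} \<and>
                f k ` f j ` F \<inter> (top_of_set F frontier_of (f k ` F)) \<noteq> {}} \<ge> 2)"

text \<open>Intended for connected \<open>X\<close> (with its subspace topology); connectedness of \<open>X\<close> is not
  part of the predicate, so that its negation never holds merely because \<open>X\<close> is disconnected.\<close>

definition cut_point :: "'a::topological_space set \<Rightarrow> 'a \<Rightarrow> bool" where
  "cut_point X x \<longleftrightarrow> x \<in> X \<and> \<not> connected (X - {x})"

end

theory Submission
  imports Defs
begin

text \<open>
  Neighbouring pieces of the ring \<open>F\<close> meet in single points, and no point belongs to three pieces
  (\<open>no_triple_point\<close>).  Removing one point therefore breaks at most one link, which leaves a chain, and a chain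
  of connected sets is connected.  So if \<open>x\<close> cuts \<open>F\<close>, then \<open>x\<close> must cut one of the
  pieces \<open>f k ` F\<close> containing it, and pulling back by \<open>f k\<close> gives a cut point \<open>f k\<^sup>-\<^sup>1 x\<close> of \<open>F\<close>
  (\<open>cut_point_descends\<close>).  Iterating yields a path of cut points \<open>y 0 = x, y 1, y 2, \<dots>\<close> with
  \<open>y i = f (k i) (y (i+1))\<close>.  Call a point of \<open>F\<close> a vertex if it lies in two of the pieces.

  A path of cut points cannot avoid the vertices (\<open>cut_path_hits_vertex\<close>).  If it did, then at each level the
  pieces other than the one around the current point would form a connected set, which lies on one side of
  the separation; the other side is squeezed into the remaining piece.  Stability guarantees that the
  side squeezed in at one level is again the side squeezed in at the next, so it shrinks to a point.  This is
  the only use of stability apart from excluding points common to three pieces.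

  Hence the path visits the finitely many vertices infinitely often, visits one of them twice, and
  so some vertex \<open>z\<close>, lying in the pieces \<open>a\<close> and \<open>b\<close>, is the fixed point of a contracting similarity
  \<open>h\<close> that maps \<open>F\<close> into the piece \<open>a\<close>.  Pulling the piece \<open>b\<close> back by the powers of \<open>h\<close> produces
  infinitely many sets that meet only in \<open>z\<close>, and inside each of them one finds a similar copy of \<open>F\<close> through
  \<open>z\<close> whose scale is bounded above and away from zero (\<open>no_fixed_vertex\<close>).

  The plane does not have room for such a pencil of copies (\<open>no_pencil_of_copies\<close>).  By compactness
  two of the similarities nearly agree.  The ring \<open>F\<close> separates the plane, so it has a hole, that is, a bounded
  complementary component.  Two corresponding small subcopies that avoid \<open>z\<close>, one in each copy, are disjoint but
  have overlapping holes, so one of them lies in the hole of the other.  The whole copy around the swallowed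
  subcopy cannot leave that hole without crossing the other subcopy, which it can meet only in \<open>z\<close>; so a whole
  copy is trapped in the hole of a subcopy, which is too small for it.
\<close>

section \<open>Similarities\<close>

text \<open>Making the ratio explicit and including surjectivity makes inverses and powers
  similarities again, with expanding ones allowed.\<close>
definition similarity :: "real \<Rightarrow> ('a::metric_space \<Rightarrow> 'a) \<Rightarrow> bool" where
  "similarity r g \<longleftrightarrow> r > 0 \<and> surj g \<and> (\<forall>x y. dist (g x) (g y) = r * dist x y)"

lemma similarity_pos: "similarity r g \<Longrightarrow> r > 0"
  and similarity_surj: "similarity r g \<Longrightarrow> surj g"
  and similarity_dist: "similarity r g \<Longrightarrow> dist (g x) (g y) = r * dist x y"
  by (auto simp: similarity_def)

lemma similarity_inj: "similarity r g \<Longrightarrow> inj g"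
  by (metis dist_eq_0_iff injI less_irrefl mult_eq_0_iff similarity_def)

lemma similarity_id: "similarity 1 id"
  by (auto simp: similarity_def)

lemma similarity_comp:
  assumes "similarity r g" "similarity s h"
  shows "similarity (r * s) (g \<circ> h)"
  using assms comp_surj[of h g] by (simp add: similarity_def)

lemma similarity_inv:
  assumes "similarity r g"
  shows "similarity (inverse r) (inv g)"
proof -
  have "dist (inv g x) (inv g y) = inverse r * dist x y" for x y
    using similarity_dist[OF assms, of "inv g x" "inv g y"] similarity_pos[OF assms]
    by (simp add: surj_f_inv_f[OF similarity_surj[OF assms]] field_simps)
  then show ?thesis
    using similarity_pos[OF assms] similarity_inj[OF assms]
    by (simp add: similarity_def inj_imp_surj_inv)
qed

lemma similarity_funpow: "similarity r g \<Longrightarrow> similarity (r ^ m) (g ^^ m)"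
proof (induction m)
  case 0
  then show ?case using similarity_id by (simp add: id_def)
next
  case (Suc m)
  then show ?case using similarity_comp[of r g "r ^ m" "g ^^ m"] by (simp add: comp_def)
qed

lemma similarity_continuous:
  assumes "similarity r g"
  shows "continuous_on S g"
proof -
  have "r-lipschitz_on S g"
    using similarity_pos[OF assms] similarity_dist[OF assms] by (intro lipschitz_onI) auto
  then show ?thesis by (rule lipschitz_on_continuous_on)
qed

lemma similarity_homeomorphism:
  assumes "similarity r g"
  shows "homeomorphism UNIV UNIV g (inv g)"
  using similarity_continuous[OF assms] similarity_continuous[OF similarity_inv[OF assms]]
    similarity_surj[OF assms] similarity_surj[OF similarity_inv[OF assms]]
    surj_f_inv_f[OF similarity_surj[OF assms]] inv_f_f[OF similarity_inj[OF assms]]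
  by (auto simp: homeomorphism_def)

lemma similarity_of_similitude:
  assumes "similitude g" "surj g"
  obtains r where "similarity r g" "r < 1"
  using assms unfolding similitude_def similarity_def by (metis greaterThanLessThan_iff)

section \<open>Holes of planar sets\<close>

text \<open>For closed \<open>K\<close> these are the bounded components of the complement of \<open>K\<close>.  In this form the
  notion is visibly preserved by similarities.\<close>
definition hole :: "'a::metric_space set \<Rightarrow> 'a set \<Rightarrow> bool" where
  "hole K U \<longleftrightarrow>
     open U \<and> connected U \<and> bounded U \<and> U \<noteq> {} \<and> U \<inter> K = {} \<and> frontier U \<subseteq> K"

lemma hole_similarity_image:
  assumes g: "similarity r g" and "hole K U"
  shows "hole (g ` K) (g ` U)"
proof -
  have U: "open U" "connected U" "bounded U" "U \<noteq> {}" "U \<inter> K = {}" "frontier U \<subseteq> K"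
    using \<open>hole K U\<close> by (auto simp: hole_def)
  note h = similarity_homeomorphism[OF g]
  have op: "open (g ` U)"
    using homeomorphism_imp_open_map[OF h, of U] U(1) by simp
  have "bounded (g ` U)"
  proof -
    obtain a e where "\<forall>y\<in>U. dist a y \<le> e"
      using U(3) by (auto simp: bounded_def)
    then have "\<forall>y\<in>g ` U. dist (g a) y \<le> r * e"
      using similarity_dist[OF g] similarity_pos[OF g] by auto
    then show ?thesis by (auto simp: bounded_def)
  qed
  moreover have "frontier (g ` U) \<subseteq> g ` K"
  proof -
    have "closed (g ` closure U)"
      using homeomorphism_imp_closed_map[OF h, of "closure U"] by simp
    then have "closure (g ` U) \<subseteq> g ` closure U"
      by (simp add: closure_minimal closure_subset image_mono)
    then have "frontier (g ` U) \<subseteq> g ` closure U - g ` U"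
      using op by (auto simp: frontier_def interior_open)
    also have "\<dots> \<subseteq> g ` frontier U"
      using U(1) by (auto simp: frontier_def interior_open)
    finally show ?thesis using U(6) by blast
  qed
  ultimately show ?thesis
    using op U connected_continuous_image[OF similarity_continuous[OF g]]
      image_Int[OF similarity_inj[OF g], of U K]
    by (auto simp: hole_def)
qed

text \<open>A connected set can leave a hole only through its frontier, which belongs to \<open>K\<close>.\<close>
lemma connected_subset_hole:
  assumes "hole K U" "connected C" "C \<inter> K = {}" "C \<inter> U \<noteq> {}"
  shows "C \<subseteq> U"
  using connected_Int_frontier[of C U] assms by (fastforce simp: hole_def)

text \<open>If \<open>K\<close> does not enter \<open>U'\<close>, then \<open>U'\<close> cannot leave \<open>U\<close>, whose frontier belongs to \<open>K\<close>.
  The frontier of \<open>U'\<close>, which belongs to \<open>K'\<close>, then lies in \<open>U\<close> as well, because \<open>K'\<close> is disjoint from \<open>K\<close>.\<close>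
lemma nested_holes:
  fixes K :: "'a::euclidean_space set"
  assumes U: "hole K U" and U': "hole K' U'"
    and conn: "connected K" "connected K'" and disj: "K \<inter> K' = {}"
    and meet: "U \<inter> U' \<noteq> {}"
  shows "K \<subseteq> U' \<or> K' \<subseteq> U"
proof (cases "K \<inter> U' = {}")
  case False
  then show ?thesis
    using connected_subset_hole[OF U' conn(1)] disj by blast
next
  case True
  have "U' \<subseteq> U"
    using connected_subset_hole[OF U, of U'] U' True meet by (auto simp: hole_def)
  then have "frontier U' \<subseteq> U \<union> K"
    using U closure_mono[of U' U] by (auto simp: hole_def frontier_def interior_open)
  moreover have "frontier U' \<noteq> {}" "frontier U' \<subseteq> K'"
    using U' frontier_not_empty[of U'] not_bounded_UNIV by (metis hole_def)+
  ultimately have "K' \<inter> U \<noteq> {}"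
    using disj by blast
  then show ?thesis
    using connected_subset_hole[OF U conn(2)] disj by blast
qed

text \<open>Two points at maximal distance in the closure of a hole lie on its frontier: an interior point could be
  moved further away from the other one.\<close>
lemma hole_dist_le:
  fixes K :: "'a::euclidean_space set"
  assumes U: "hole K U" and xy: "x \<in> U" "y \<in> U" "x \<noteq> y"
  shows "\<exists>a\<in>K. \<exists>b\<in>K. dist x y \<le> dist a b"
proof -
  have cpt: "compact (closure U)" "closure U \<noteq> {}"
    using U by (auto simp: hole_def)
  obtain a b where ab: "a \<in> closure U" "b \<in> closure U"
    and max: "\<And>u v. u \<in> closure U \<Longrightarrow> v \<in> closure U \<Longrightarrow> dist u v \<le> dist a b"
    using compact_sup_maxdistance[OF cpt] by blast
  have sub: "U \<subseteq> closure U" by (rule closure_subset)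
  have ne: "a \<noteq> b"
    using max[of x y] xy sub by (metis dist_le_zero_iff dist_self subsetD)
  have move: "p \<notin> U" if "p \<noteq> q" "q \<in> closure U" "dist p q = dist a b" for p q
  proof
    assume "p \<in> U"
    then obtain e where e: "e > 0" "cball p e \<subseteq> U"
      using U open_contains_cball by (metis hole_def)
    define t where "t = e / norm (p - q)"
    have t: "t > 0" using e that by (simp add: t_def)
    have "dist p (p + t *\<^sub>R (p - q)) = e"
      using e that(1) by (simp add: t_def dist_norm)
    then have "p + t *\<^sub>R (p - q) \<in> closure U"
      using e sub by (auto simp: subset_eq)
    from max[OF this that(2)] have "dist (p + t *\<^sub>R (p - q)) q \<le> norm (p - q)"
      using that by (simp add: dist_norm)
    moreover have "p + t *\<^sub>R (p - q) - q = (1 + t) *\<^sub>R (p - q)"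
      by (simp add: algebra_simps)
    ultimately have "(1 + t) * norm (p - q) \<le> norm (p - q)"
      using t by (simp add: dist_norm)
    then show False using t that by (simp add: algebra_simps mult_le_0_iff)
  qed
  have "a \<notin> U" "b \<notin> U"
    using move[of a b] move[of b a] ab ne by (auto simp: dist_commute)
  then have "a \<in> K" "b \<in> K"
    using U ab by (auto simp: hole_def frontier_def interior_open)
  moreover have "dist x y \<le> dist a b"
    using max xy sub by blast
  ultimately show ?thesis by blast
qed

text \<open>The library result concerns the complex plane; a linear isomorphism transports it.\<close>
lemma Borsukian_separation_compact_plane:
  fixes S :: "(real^2) set"
  assumes "compact S"
  shows "Borsukian S \<longleftrightarrow> connected (- S)"
proof -
  have "dim (UNIV :: (real^2) set) = dim (UNIV :: complex set)"
    by simp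
  from isometries_subspaces[OF subspace_UNIV subspace_UNIV this]
  obtain h :: "real^2 \<Rightarrow> complex" and k
    where hk: "linear h" "h ` UNIV = UNIV" "linear k" "\<And>x. k (h x) = x" by (metis UNIV_I)
  have inj: "inj h" by (metis hk(4) injI)
  have "Borsukian S \<longleftrightarrow> Borsukian (h ` S)"
    by (simp add: Borsukian_injective_linear_image hk inj)
  also have "\<dots> \<longleftrightarrow> connected (- (h ` S))"
    by (intro Borsukian_separation_compact compact_continuous_image assms
        linear_continuous_on hk(1) linear_conv_bounded_linear[THEN iffD1])
  also have "- (h ` S) = h ` (- S)"
    using hk(2) inj by (metis Compl_eq_Diff_UNIV image_set_diff)
  also have "connected (h ` (- S)) \<longleftrightarrow> connected (- S)"
  proof
    assume "connected (h ` (- S))"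
    then have "connected (k ` h ` (- S))"
      by (rule connected_linear_image[OF hk(3)])
    then show "connected (- S)" by (simp add: image_image hk(4))
  qed (rule connected_linear_image[OF hk(1)])
  finally show ?thesis .
qed

text \<open>A converse of Janiszewski's theorem.  A compact set that does not separate the plane is Borsukian, hence
  unicoherent, so that two connected closed sets covering it must have connected intersection.\<close>
lemma ex_hole:
  fixes S T :: "(real^2) set"
  assumes "compact S" "compact T" "connected S" "connected T" "\<not> connected (S \<inter> T)"
  shows "\<exists>U. hole (S \<union> T) U"
proof -
  let ?K = "S \<union> T"
  have K: "compact ?K" using assms by blast
  have "\<not> unicoherent ?K"
  proof
    assume "unicoherent ?K"
    then have "connected (S \<inter> T)"
      using assms by (intro unicoherentD) (auto simp: closed_subset compact_imp_closed)
    with assms show False by blast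
  qed
  moreover have "connected ?K"
    using assms by (metis connected_Un connected_empty)
  ultimately have nc: "\<not> connected (- ?K)"
    using Borsukian_imp_unicoherent Borsukian_separation_compact_plane[OF K] by blast
  have "inside ?K \<noteq> {}"
  proof
    assume "inside ?K = {}"
    then have "- ?K = outside ?K" using inside_Un_outside by blast
    moreover have "connected (outside ?K)"
      by (rule connected_outside) (use assms in \<open>auto simp: compact_imp_bounded\<close>)
    ultimately show False using nc by simp
  qed
  then obtain p where p: "p \<notin> ?K" "bounded (connected_component_set (- ?K) p)"
    by (auto simp: inside_def)
  have "hole ?K (connected_component_set (- ?K) p)"
    unfolding hole_def
  proof (intro conjI)
    show "open (connected_component_set (- ?K) p)"
      using K by (intro open_connected_component open_Compl compact_imp_closed)
    show "frontier (connected_component_set (- ?K) p) \<subseteq> ?K"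
      using frontier_of_connected_component_subset[of "- ?K" p]
        frontier_subset_closed[OF compact_imp_closed[OF K]]
      unfolding frontier_complement by (rule order_trans)
    show "connected_component_set (- ?K) p \<inter> ?K = {}"
      using connected_component_subset by fastforce
    show "connected_component_set (- ?K) p \<noteq> {}"
      using p(1) connected_component_eq_empty[of "- ?K" p] by blast
  qed (use p in auto)
  then show ?thesis by blast
qed

text \<open>The pigeonhole principle in a totally bounded set, applied to finitely many coordinates in turn.\<close>
lemma infinite_subset_pairwise_close:
  fixes g :: "nat \<Rightarrow> 'i \<Rightarrow> 'a::heine_borel"
  assumes "finite I" "infinite S" "\<And>i. i \<in> I \<Longrightarrow> bounded (range (\<lambda>m. g m i))" "e > 0"
  shows "\<exists>S'\<subseteq>S. infinite S' \<and> (\<forall>m\<in>S'. \<forall>k\<in>S'. \<forall>i\<in>I. dist (g m i) (g k i) < e)"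
  using assms(1-3)
proof (induction I arbitrary: S)
  case empty
  then show ?case by auto
next
  case (insert i I)
  obtain T where T: "T \<subseteq> S" "infinite T" "\<forall>m\<in>T. \<forall>k\<in>T. \<forall>i\<in>I. dist (g m i) (g k i) < e"
    using insert.IH[OF insert.prems(1)] insert.prems(2) by blast
  let ?R = "range (\<lambda>m. g m i)"
  have "compact (closure ?R)"
    using insert.prems(2)[of i] by simp
  moreover have "e/2 > 0" using \<open>e > 0\<close> by simp
  ultimately obtain N where N: "finite N" "closure ?R \<subseteq> (\<Union>x\<in>N. ball x (e/2))"
    unfolding compact_eq_totally_bounded by blast
  have "?R \<subseteq> (\<Union>x\<in>N. ball x (e/2))"
    by (rule order_trans[OF closure_subset N(2)])
  then have "T \<subseteq> (\<Union>x\<in>N. {m \<in> T. g m i \<in> ball x (e/2)})"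
    by blast
  with T(2) have "infinite (\<Union>x\<in>N. {m \<in> T. g m i \<in> ball x (e/2)})"
    by (rule infinite_super[rotated])
  with N(1) obtain x where x: "infinite {m \<in> T. g m i \<in> ball x (e/2)}"
    by (auto simp only: finite_UN)
  let ?T = "{m \<in> T. g m i \<in> ball x (e/2)}"
  have "dist (g m i) (g l i) < e" if "m \<in> ?T" "l \<in> ?T" for m l
  proof (rule dist_triangle_half_r)
    show "dist x (g m i) < e/2" "dist x (g l i) < e/2"
      using that by simp_all
  qed
  then have "\<forall>m\<in>?T. \<forall>k\<in>?T. \<forall>i\<in>insert i I. dist (g m i) (g k i) < e"
    using T(3) by simp
  moreover have "?T \<subseteq> S"
    using T(1) by blast
  ultimately show ?case
    using x by (intro exI[of _ ?T] conjI)
qed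

lemma connected_chain_UN:
  assumes "\<And>i. i \<le> m \<Longrightarrow> connected (H i)" "\<And>i. i < m \<Longrightarrow> H i \<inter> H (Suc i) \<noteq> {}"
  shows "connected (\<Union>i\<le>(m::nat). H i)"
  using assms
proof (induction m)
  case 0
  then show ?case by simp
next
  case (Suc m)
  have "connected ((\<Union>i\<le>m. H i) \<union> H (Suc m))"
  proof (rule connected_Un)
    show "(\<Union>i\<le>m. H i) \<inter> H (Suc m) \<noteq> {}"
      using Suc.prems(2)[of m] by auto
  qed (use Suc in auto)
  then show ?case by (simp add: atMost_Suc Un_commute)
qed

section \<open>Rings of pieces and triple points\<close>

lemma connected_subset_clopen:
  assumes "connected Y" "Y \<subseteq> X" "openin (top_of_set X) A" "closedin (top_of_set X) A" "Y \<inter> A \<noteq> {}"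
  shows "Y \<subseteq> A"
proof -
  obtain S T where "open S" "A = X \<inter> S" "closed T" "A = X \<inter> T"
    using assms(3,4) by (auto simp: openin_open closedin_closed)
  then have "openin (top_of_set Y) (Y \<inter> A)" "closedin (top_of_set Y) (Y \<inter> A)"
    using assms(2) by (metis inf.absorb_iff1 inf_assoc openin_open closedin_closed)+
  then show ?thesis
    using assms(1,5) unfolding connected_clopen by (metis inf.absorb_iff1)
qed

lemma two_elements:
  assumes "card P \<ge> 2"
  shows "\<exists>a\<in>P. \<exists>b\<in>P. a \<noteq> b"
proof (rule ccontr)
  assume "\<not> ?thesis"
  moreover have "finite P" using assms by (intro card_ge_0_finite) simp
  ultimately have "card P \<le> Suc 0" by (subst card_le_Suc0_iff_eq) auto
  with assms show False by simp
qed

locale stable_similar_necklace =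
  fixes n :: nat and f :: "nat \<Rightarrow> real^2 \<Rightarrow> real^2" and F :: "(real^2) set" and c :: "nat \<Rightarrow> real"
  assumes neck: "necklace n f F"
    and stable: "stable_necklace n f F"
    and sim: "k \<in> {1..n} \<Longrightarrow> similarity (c k) (f k)"
    and ratio_less: "k \<in> {1..n} \<Longrightarrow> c k < 1"
begin

abbreviation piece :: "nat \<Rightarrow> (real^2) set" where
  "piece k \<equiv> f k ` F"

definition vertices :: "(real^2) set" where
  "vertices = (\<Union>a\<in>{1..n}. \<Union>b\<in>{1..n} - {a}. piece a \<inter> piece b)"

text \<open>The \<open>i\<close>-th index after \<open>l\<close>, starting with the immediate successor, in the cyclic order of
  \<open>{1..n}\<close>: the indices \<open>cyc l 0, \<dots>, cyc l (n - 1)\<close> run once around the ring and end in \<open>l\<close>.\<close>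
definition cyc :: "nat \<Rightarrow> nat \<Rightarrow> nat" where
  "cyc l i = (l + i) mod n + 1"

lemma n_ge_3: "n \<ge> 3"
  and compact_F: "compact F"
  and F_nonempty: "F \<noteq> {}"
  and F_eq: "F = (\<Union>k\<in>{1..n}. piece k)"
  using neck by (auto simp: necklace_def attractor_def)

lemma piece_subset: "k \<in> {1..n} \<Longrightarrow> piece k \<subseteq> F"
  using F_eq by blast

lemma in_some_piece: "x \<in> F \<Longrightarrow> \<exists>k\<in>{1..n}. x \<in> piece k"
  using F_eq by blast

lemma inj_f: "k \<in> {1..n} \<Longrightarrow> inj (f k)"
  using sim similarity_inj by blast

lemma pieces_meet:
  assumes "a \<in> {1..n}" "b \<in> {1..n}" "a \<noteq> b" "\<bar>int a - int b\<bar> = 1 \<or> \<bar>int a - int b\<bar> = int n - 1"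
  shows "is_singleton (piece a \<inter> piece b)"
  using neck assms by (auto simp: necklace_def)

lemma meeting_pieces_adjacent:
  assumes "a \<in> {1..n}" "b \<in> {1..n}" "a \<noteq> b" "x \<in> piece a" "x \<in> piece b"
  shows "\<bar>int a - int b\<bar> = 1 \<or> \<bar>int a - int b\<bar> = int n - 1"
proof (rule ccontr)
  assume "\<not> ?thesis"
  then have "2 \<le> \<bar>int a - int b\<bar> \<and> \<bar>int a - int b\<bar> \<le> int n - 2"
    using assms(1-3) by auto
  then have "piece a \<inter> piece b = {}"
    using neck assms(1-3) unfolding necklace_def by blast
  with assms show False by blast
qed

lemma meeting_point_unique:
  assumes "a \<in> {1..n}" "b \<in> {1..n}" "a \<noteq> b" "x \<in> piece a" "x \<in> piece b" "y \<in> piece a" "y \<in> piece b"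
  shows "x = y"
proof -
  have "is_singleton (piece a \<inter> piece b)"
    using pieces_meet meeting_pieces_adjacent assms(1-5) by blast
  then obtain p where "piece a \<inter> piece b = {p}"
    by (rule is_singletonE)
  then show ?thesis
    using assms(4-7) by (metis IntI singletonD)
qed

lemma compact_piece: "k \<in> {1..n} \<Longrightarrow> compact (piece k)"
  using compact_F compact_continuous_image similarity_continuous sim by blast

text \<open>The other pieces form a closed set, so a point of the piece \<open>k\<close> outside all of them is interior.\<close>
lemma frontier_point_shared:
  assumes k: "k \<in> {1..n}" and p: "p \<in> top_of_set F frontier_of (piece k)"
  shows "\<exists>i\<in>{1..n} - {k}. p \<in> piece i"
proof (rule ccontr)
  assume no: "\<not> ?thesis"
  let ?Y = "\<Union>i\<in>{1..n} - {k}. piece i"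
  have "compact ?Y"
    using compact_piece by (intro compact_UN) auto
  then have "openin (top_of_set F) (F \<inter> - ?Y)"
    by (intro openin_open_Int open_Compl compact_imp_closed)
  then have "openin (top_of_set F) (F - ?Y)"
    by (simp only: Diff_eq)
  moreover have "F - ?Y \<subseteq> piece k"
    using F_eq by blast
  ultimately have "F - ?Y \<subseteq> top_of_set F interior_of (piece k)"
    by (simp add: interior_of_maximal)
  moreover have "p \<in> F"
    using p frontier_of_subset_topspace by fastforce
  ultimately show False
    using p no by (auto simp: frontier_of_def)
qed

text \<open>The form in which stability is used: the two sets counted are distinct, hence come from distinct
  pieces, and their frontier points are shared with neighbours of the piece \<open>k\<close>.\<close>
lemma stable_obtain:
  assumes "k \<in> {1..n}"
  obtains i j p q where "i \<in> {1..n}" "j \<in> {1..n}" "piece i \<noteq> piece j"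
    "p \<in> piece i" "q \<in> piece j"
    "\<exists>a\<in>{1..n} - {k}. f k p \<in> piece a" "\<exists>a\<in>{1..n} - {k}. f k q \<in> piece a"
proof -
  let ?P = "{f k ` f j ` F | j. j \<in> {1..n} \<and>
                f k ` f j ` F \<inter> (top_of_set F frontier_of (f k ` F)) \<noteq> {}}"
  have "card ?P \<ge> 2"
    using stable assms unfolding stable_necklace_def by blast
  then obtain P Q where PQ: "P \<in> ?P" "Q \<in> ?P" "P \<noteq> Q"
    using two_elements[of ?P] by blast
  obtain i j where ij: "i \<in> {1..n}" "j \<in> {1..n}" "P = f k ` piece i" "Q = f k ` piece j"
    "P \<inter> (top_of_set F frontier_of (f k ` F)) \<noteq> {}" "Q \<inter> (top_of_set F frontier_of (f k ` F)) \<noteq> {}"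
    using PQ by blast
  obtain p q where "p \<in> piece i" "f k p \<in> top_of_set F frontier_of (f k ` F)"
    "q \<in> piece j" "f k q \<in> top_of_set F frontier_of (f k ` F)"
    using ij by blast
  moreover have "piece i \<noteq> piece j"
    using PQ ij by blast
  ultimately show ?thesis
    using ij(1,2) frontier_point_shared[OF assms] by (intro that[of i j p q])
qed

text \<open>A point of \<open>F\<close> farthest from the common fixed point is the image of a point that would be
  farther still, unless both coincide with the fixed point.\<close>
lemma all_fixed_imp_singleton:
  assumes "\<And>k. k \<in> {1..n} \<Longrightarrow> f k x = x"
  shows "F = {x}"
proof -
  obtain y where y: "y \<in> F" "\<And>z. z \<in> F \<Longrightarrow> dist x z \<le> dist x y"
    using distance_attains_sup[OF compact_F F_nonempty] by blast
  obtain k y' where k: "k \<in> {1..n}" "y' \<in> F" "y = f k y'"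
    using in_some_piece[OF y(1)] by blast
  have "dist x y = c k * dist x y'"
    using similarity_dist[OF sim[OF k(1)], of x y'] assms[OF k(1)] k(3) by simp
  also have "\<dots> \<le> c k * dist x y"
    using y(2)[OF k(2)] similarity_pos[OF sim[OF k(1)]] by simp
  finally have "dist x y \<le> 0"
    using ratio_less[OF k(1)]
    by (simp add: mult_le_cancel_right1 not_less)
  then have "z = x" if "z \<in> F" for z
    using y(2)[OF that] by (metis dist_le_zero_iff order_trans)
  then show ?thesis
    using F_nonempty by blast
qed

text \<open>Among three distinct indices two are non-adjacent unless \<open>n = 3\<close>.  For \<open>n = 3\<close> a triple point \<open>x\<close>
  would be the only point shared by any two pieces.  Then stability forces each \<open>f k\<close> to pull \<open>x\<close> back to a
  shared point, hence to fix \<open>x\<close>, and \<open>F\<close> collapses to \<open>{x}\<close>, which is not stable.\<close>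
lemma no_triple_point:
  assumes abd: "a \<in> {1..n}" "b \<in> {1..n}" "d \<in> {1..n}" "a \<noteq> b" "a \<noteq> d" "b \<noteq> d"
    and x: "x \<in> piece a" "x \<in> piece b" "x \<in> piece d"
  shows False
proof -
  have "n = 3"
    using meeting_pieces_adjacent[of a b x] meeting_pieces_adjacent[of a d x]
      meeting_pieces_adjacent[of b d x] abd x n_ge_3 by auto
  have in_all: "k \<in> {a, b, d}" if "k \<in> {1..n}" for k
    using that abd \<open>n = 3\<close> by auto
  have shared: "p = x" if "i \<in> {1..n}" "j \<in> {1..n}" "i \<noteq> j" "p \<in> piece i" "p \<in> piece j" for i j p
    using that in_all[of i] in_all[of j] x meeting_point_unique[of i j p x] by blast
  have fixed: "f k x = x" if k: "k \<in> {1..n}" for k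
  proof -
    obtain i j p q where ij: "i \<in> {1..n}" "j \<in> {1..n}" "piece i \<noteq> piece j"
      "p \<in> piece i" "q \<in> piece j"
      "\<exists>a\<in>{1..n} - {k}. f k p \<in> piece a" "\<exists>a\<in>{1..n} - {k}. f k q \<in> piece a"
      using stable_obtain[OF k] .
    have "p \<in> F" "q \<in> F" using ij piece_subset by blast+
    then have "f k p = x" "f k q = x"
      using ij(6,7) shared[of k _ "f k p"] shared[of k _ "f k q"] k by blast+
    moreover from this have "p = q"
      using inj_f[OF k] by (metis injD)
    ultimately show ?thesis
      using shared[OF ij(1,2) _ ij(4)] ij(3,5) by metis
  qed
  then have "F = {x}" by (rule all_fixed_imp_singleton)
  then have "piece i = {x}" if "i \<in> {1..n}" for i
    using fixed that by simp
  then show False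
    using stable_obtain[OF abd(1)] by metis
qed

lemma vertices_iff:
  "x \<in> vertices \<longleftrightarrow> (\<exists>a\<in>{1..n}. \<exists>b\<in>{1..n}. a \<noteq> b \<and> x \<in> piece a \<and> x \<in> piece b)"
  by (auto simp: vertices_def)

lemma not_in_other_piece:
  assumes "k \<in> {1..n}" "x \<in> piece k" "x \<notin> vertices" "i \<in> {1..n} - {k}"
  shows "x \<notin> piece i"
  using assms(3) unfolding vertices_iff
  by (metis DiffE assms(1,2,4) singletonI)

lemma other_pieces_subset:
  assumes "k \<in> {1..n}" "x \<in> piece k" "x \<notin> vertices"
  shows "(\<Union>i\<in>{1..n} - {k}. piece i) \<subseteq> F - {x}"
proof (rule UN_least)
  fix i assume "i \<in> {1..n} - {k}"
  then show "piece i \<subseteq> F - {x}"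
    using piece_subset[of i] not_in_other_piece[OF assms, of i] by auto
qed

text \<open>Stability provides two distinct pieces whose images under \<open>f k\<close> touch neighbours of the piece \<open>k\<close>, and
  at most one of the two is the \<open>l\<close>-th.\<close>
lemma boundary_not_in_one_piece:
  assumes k: "k \<in> {1..n}"
  shows "\<exists>j\<in>{1..n} - {l}. \<exists>p\<in>piece j. \<exists>i\<in>{1..n} - {k}. f k p \<in> piece i"
proof -
  obtain i j p q where ij: "i \<in> {1..n}" "j \<in> {1..n}" "piece i \<noteq> piece j"
    "p \<in> piece i" "q \<in> piece j"
    "\<exists>a\<in>{1..n} - {k}. f k p \<in> piece a" "\<exists>a\<in>{1..n} - {k}. f k q \<in> piece a"
    using stable_obtain[OF k] .
  show ?thesis
  proof (cases "i = l")
    case True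
    then have "j \<in> {1..n} - {l}" using ij(2,3) by auto
    then show ?thesis using ij(5,7) by blast
  next
    case False
    then have "i \<in> {1..n} - {l}" using ij(1) by auto
    then show ?thesis using ij(4,6) by blast
  qed
qed

lemma finite_vertices: "finite vertices"
proof -
  have "finite (piece a \<inter> piece b)" if "a \<in> {1..n}" "b \<in> {1..n} - {a}" for a b
  proof (cases "piece a \<inter> piece b = {}")
    case False
    then obtain x where "x \<in> piece a \<inter> piece b" by blast
    then have "piece a \<inter> piece b \<subseteq> {x}"
      using meeting_point_unique[of a b _ x] that by auto
    then show ?thesis by (rule finite_subset) simp
  qed simp
  then show ?thesis unfolding vertices_def by blast
qed

lemma F_two_points: "\<exists>x\<in>F. \<exists>y\<in>F. x \<noteq> y"
proof (rule ccontr)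
  assume "\<not> ?thesis"
  then obtain x where "F = {x}" using F_nonempty by blast
  then have "x \<in> piece k" if "k \<in> {1..n}" for k
    using piece_subset[OF that] by simp
  then show False
    using n_ge_3 by (intro no_triple_point[of 1 2 3 x]) simp_all
qed

lemma piece_two_points: "k \<in> {1..n} \<Longrightarrow> \<exists>x\<in>piece k. \<exists>y\<in>piece k. x \<noteq> y"
  using F_two_points inj_f by (metis image_eqI injD)

lemma cyc_in: "cyc l i \<in> {1..n}"
  using n_ge_3 by (simp add: cyc_def Suc_leI)

lemma cyc_Suc: "cyc l (Suc i) = (if cyc l i = n then 1 else cyc l i + 1)"
  using n_ge_3 by (auto simp: cyc_def mod_Suc)

lemma cyc_eq_iff:
  assumes "i < n" "j < n"
  shows "cyc l i = cyc l j \<longleftrightarrow> i = j"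
proof -
  have *: "i = j" if "i \<le> j" "j < n" "(l + j) mod n = (l + i) mod n" for i j
  proof -
    have "n dvd (l + j) - (l + i)"
      using that by (subst mod_eq_dvd_iff_nat[symmetric]) auto
    then show ?thesis
      using that by (auto dest: dvd_imp_le)
  qed
  show ?thesis
    using *[of i j] *[of j i] assms by (auto simp: cyc_def) (metis nle_le)
qed

lemma cyc_surj: "cyc l ` {..<n} = {1..n}"
proof (rule card_subset_eq)
  have "inj_on (cyc l) {..<n}"
    by (auto simp: inj_on_def cyc_eq_iff)
  then show "card (cyc l ` {..<n}) = card {1..n}"
    by (simp add: card_image)
qed (use cyc_in in auto)

lemma cyc_last: "l \<in> {1..n} \<Longrightarrow> cyc l (n - 1) = l"
  using n_ge_3 by (cases l) (auto simp: cyc_def)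

lemma cyc_link: "piece (cyc l i) \<inter> piece (cyc l (Suc i)) \<noteq> {}"
proof -
  have "is_singleton (piece (cyc l i) \<inter> piece (cyc l (Suc i)))"
    using cyc_in[of l i] cyc_in[of l "Suc i"] n_ge_3
    by (intro pieces_meet) (auto simp: cyc_Suc split: if_splits)
  then show ?thesis by (metis is_singleton_def insert_not_empty)
qed

lemma adjacent_cyc:
  assumes "a \<in> {1..n}" "b \<in> {1..n}" "a \<noteq> b" "x \<in> piece a" "x \<in> piece b"
  shows "b = cyc a 0 \<or> a = cyc b 0"
proof -
  have "cyc k 0 = (if k = n then 1 else k + 1)" if "k \<in> {1..n}" for k
    using that by (auto simp: cyc_def)
  then show ?thesis
    using meeting_pieces_adjacent[OF assms] assms by auto
qed

section \<open>Connectedness and paths of cut points\<close>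

definition c_max :: real where "c_max = Max (c ` {1..n})"

lemma ratio_le_max: "k \<in> {1..n} \<Longrightarrow> c k \<le> c_max"
  by (simp add: c_max_def)

lemma c_max_bounds: "0 < c_max" "c_max < 1"
proof -
  have "1 \<in> {1..n}" using n_ge_3 by simp
  then show "0 < c_max"
    using ratio_le_max similarity_pos[OF sim] by (meson less_le_trans)
  show "c_max < 1"
    using ratio_less n_ge_3 unfolding c_max_def by (subst Max_less_iff) auto
qed

lemma dist_f_le: "k \<in> {1..n} \<Longrightarrow> dist (f k x) (f k y) \<le> c_max * dist x y"
  using similarity_dist[OF sim] ratio_le_max by (simp add: mult_right_mono)

lemma dist_le_diameter: "x \<in> F \<Longrightarrow> y \<in> F \<Longrightarrow> dist x y \<le> diameter F"
  using compact_F compact_imp_bounded diameter_bounded_bound by blast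

text \<open>A function that does not distinguish points at distance below \<open>d\<close> becomes, after composition with
  \<open>f k\<close>, one that does not distinguish points at distance below \<open>d / c_max\<close>.  After finitely many steps this
  exceeds the diameter.  On the way back, neighbouring pieces share points, so the constants
  agree around the ring.\<close>
lemma step_function_constant:
  assumes "\<And>x y. x \<in> F \<Longrightarrow> y \<in> F \<Longrightarrow> dist x y < d \<Longrightarrow> s x = s y"
    and "c_max ^ m * diameter F < d" and "x \<in> F" "y \<in> F"
  shows "s x = s y"
  using assms
proof (induction m arbitrary: s d x y)
  case 0
  then show ?case
    using dist_le_diameter by (metis le_less_trans mult_1 power_0)
next
  case (Suc m)
  have on_piece: "s p = s q" if k: "k \<in> {1..n}" and pq: "p \<in> piece k" "q \<in> piece k" for k p q
  proof -
    have "(s \<circ> f k) u = (s \<circ> f k) v" if "u \<in> F" "v \<in> F" for u v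
    proof (rule Suc.IH[where d = "d / c_max"])
      fix u v assume uv: "u \<in> F" "v \<in> F" "dist u v < d / c_max"
      then have "dist (f k u) (f k v) < d"
        using dist_f_le[OF k, of u v] c_max_bounds by (simp add: field_simps)
      then show "(s \<circ> f k) u = (s \<circ> f k) v"
        using Suc.prems(1) uv piece_subset[OF k] by auto
    next
      show "c_max ^ m * diameter F < d / c_max"
        using Suc.prems(2) c_max_bounds by (simp add: field_simps)
    qed (use that in auto)
    then show ?thesis using pq by auto
  qed
  have chain: "s p = s q" if "i < n" "p \<in> piece (cyc 0 0)" "q \<in> piece (cyc 0 i)" for i p q
    using that
  proof (induction i arbitrary: q)
    case 0
    then show ?case using on_piece cyc_in by blast
  next
    case (Suc i)
    then show ?case
    proof -
      obtain r where r: "r \<in> piece (cyc 0 i)" "r \<in> piece (cyc 0 (Suc i))"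
        using cyc_link[of 0 i] by blast
      have "s p = s r" using Suc r(1) by simp
      also have "s r = s q" using on_piece[OF cyc_in r(2)] Suc.prems by simp
      finally show ?thesis .
    qed
  qed
  obtain p where p: "p \<in> piece (cyc 0 0)" using F_nonempty by blast
  have "s z = s p" if z: "z \<in> F" for z
  proof -
    obtain i where "i < n" "z \<in> piece (cyc 0 i)"
      using in_some_piece[OF z] cyc_surj[of 0] by (metis imageE lessThan_iff)
    then show ?thesis using chain[OF _ p] by simp
  qed
  then show ?case using Suc.prems(3,4) by simp
qed

text \<open>A separation of a compact set has a positive gap, so membership in one side is a step function of
  the kind just treated.\<close>
lemma connected_F: "connected F"
proof (rule ccontr)
  assume "\<not> connected F"
  then obtain A B where AB: "closed A" "closed B" "F \<subseteq> A \<union> B" "A \<inter> B \<inter> F = {}"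
    "A \<inter> F \<noteq> {}" "B \<inter> F \<noteq> {}"
    unfolding connected_closed by blast
  have "compact (A \<inter> F)" "closed (B \<inter> F)"
    using AB compact_F by (auto simp: compact_imp_closed closed_Int_compact)
  then obtain d where d: "d > 0" "\<forall>x\<in>A \<inter> F. \<forall>y\<in>B \<inter> F. d \<le> dist x y"
    using separate_compact_closed[of "A \<inter> F" "B \<inter> F"] AB by auto
  have "(\<lambda>m. c_max ^ m * diameter F) \<longlonglongrightarrow> 0"
    using c_max_bounds by (intro tendsto_mult_left_zero LIMSEQ_power_zero) auto
  then obtain m where m: "c_max ^ m * diameter F < d"
    using d(1) by (metis (mono_tags) eventually_sequentially order_tendstoD(2) order_refl)
  have half: "y \<in> A" if "x \<in> F" "y \<in> F" "dist x y < d" "x \<in> A" for x y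
  proof (rule ccontr)
    assume "y \<notin> A"
    then have "y \<in> B \<inter> F" using AB(3) that(2) by blast
    then have "d \<le> dist x y" using d(2) that(1,4) by blast
    then show False using that(3) by simp
  qed
  have same: "(x \<in> A) = (y \<in> A)" if "x \<in> F" "y \<in> F" for x y
  proof (rule step_function_constant[OF _ m that])
    fix x y assume "x \<in> F" "y \<in> F" "dist x y < d"
    then show "(x \<in> A) = (y \<in> A)"
      using half[of x y] half[of y x] by (auto simp: dist_commute)
  qed
  obtain x y where "x \<in> A \<inter> F" "y \<in> B \<inter> F" using AB(5,6) by blast
  then show False using same[of x y] AB(4) by blast
qed

lemma connected_piece: "k \<in> {1..n} \<Longrightarrow> connected (piece k)"
  using connected_F connected_continuous_image similarity_continuous sim by blast

lemma connected_other_pieces: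
  assumes l: "l \<in> {1..n}"
  shows "connected (\<Union>k\<in>{1..n} - {l}. piece k)"
proof -
  have "{..<n} = insert (n - 1) {..n - 2}" using n_ge_3 by auto
  then have "cyc l ` {..<n} = insert l (cyc l ` {..n - 2})"
    using cyc_last[OF l] by simp
  moreover have "l \<notin> cyc l ` {..n - 2}"
    using cyc_last[OF l] cyc_eq_iff[of "n - 1" _ l] n_ge_3 by fastforce
  ultimately have "{1..n} - {l} = cyc l ` {..n - 2}"
    using cyc_surj by auto
  moreover have "connected (\<Union>i\<le>n - 2. piece (cyc l i))"
    using connected_piece cyc_in cyc_link by (intro connected_chain_UN) auto
  ultimately show ?thesis by simp
qed

text \<open>Since there are no triple points, \<open>x\<close> destroys at most one of the \<open>n\<close> links of the ring.  Running
  once around the ring from just after that link uses only the other \<open>n - 1\<close> links.\<close>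
lemma ring_without_point:
  obtains p where "\<And>i. i < n - 1 \<Longrightarrow> piece (cyc p i) \<inter> piece (cyc p (Suc i)) - {x} \<noteq> {}"
proof (cases "x \<in> vertices")
  case False
  have "piece (cyc 1 i) \<inter> piece (cyc 1 (Suc i)) - {x} \<noteq> {}" if "i < n - 1" for i
  proof -
    have "cyc 1 i \<noteq> cyc 1 (Suc i)"
      using that by (subst cyc_eq_iff) auto
    then have "x \<notin> piece (cyc 1 i) \<inter> piece (cyc 1 (Suc i))"
      using False cyc_in vertices_iff by blast
    then show ?thesis using cyc_link[of 1 i] by blast
  qed
  then show ?thesis by (rule that)
next
  case True
  then obtain p where p: "p \<in> {1..n}" "x \<in> piece p" "x \<in> piece (cyc p 0)"
    using adjacent_cyc vertices_iff by metis
  have "piece (cyc p i) \<inter> piece (cyc p (Suc i)) - {x} \<noteq> {}" if i: "i < n - 1" for i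
  proof
    assume "piece (cyc p i) \<inter> piece (cyc p (Suc i)) - {x} = {}"
    then have x: "x \<in> piece (cyc p i)" "x \<in> piece (cyc p (Suc i))"
      using cyc_link[of p i] by blast+
    define j where "j = (if i = 0 then 1 else i)"
    have j: "j < n" "j \<noteq> 0" "j \<noteq> n - 1" "x \<in> piece (cyc p j)"
      using i x n_ge_3 by (auto simp: j_def)
    have "cyc p 0 \<noteq> cyc p (n - 1)" "cyc p 0 \<noteq> cyc p j" "cyc p (n - 1) \<noteq> cyc p j"
      using j n_ge_3 by (auto simp: cyc_eq_iff)
    then show False
      using no_triple_point[of "cyc p 0" "cyc p (n - 1)" "cyc p j" x] cyc_in j p cyc_last[OF p(1)]
      by auto
  qed
  then show ?thesis by (rule that)
qed

text \<open>If every piece stays connected after the removal of \<open>x\<close>, then so does their chain.\<close>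
lemma cut_point_descends:
  assumes "\<not> connected (F - {x})"
  shows "\<exists>k\<in>{1..n}. \<exists>y\<in>F. x = f k y \<and> \<not> connected (F - {y})"
proof (rule ccontr)
  assume no: "\<not> ?thesis"
  have conn: "connected (piece k - {x})" if k: "k \<in> {1..n}" for k
  proof (cases "x \<in> piece k")
    case True
    then obtain y where y: "y \<in> F" "x = f k y" by blast
    then have "connected (f k ` (F - {y}))"
      using no k connected_continuous_image similarity_continuous sim by blast
    moreover have "f k ` (F - {y}) = piece k - {x}"
      using y image_set_diff[OF inj_f[OF k], of F "{y}"] by simp
    ultimately show ?thesis by simp
  qed (use connected_piece k in simp)
  obtain p where p: "\<And>i. i < n - 1 \<Longrightarrow> piece (cyc p i) \<inter> piece (cyc p (Suc i)) - {x} \<noteq> {}"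
    using ring_without_point[of x] by blast
  have "connected (\<Union>i\<le>n - 1. piece (cyc p i) - {x})"
  proof (rule connected_chain_UN)
    fix i assume "i < n - 1"
    from p[OF this] show "(piece (cyc p i) - {x}) \<inter> (piece (cyc p (Suc i)) - {x}) \<noteq> {}"
      by blast
  qed (use conn cyc_in in blast)
  moreover have "{..n - 1} = {..<n}" using n_ge_3 by auto
  then have "(\<Union>i\<le>n - 1. piece (cyc p i) - {x}) = (\<Union>k\<in>{1..n}. piece k) - {x}"
    using cyc_surj[of p, symmetric] by auto
  ultimately show False
    using assms F_eq by simp
qed

text \<open>The squeezing argument.  Let \<open>A\<close> be a side of a separation at \<open>x 0\<close> that is contained in the
  piece \<open>k 0\<close>.  Its pullback \<open>A'\<close> is a side of a separation at \<open>x 1\<close>.  The pieces other than \<open>k 1\<close>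
  form a connected set missing \<open>x 1\<close>.  By stability one of them contains a point that \<open>f (k 0)\<close> maps into a neighbour
  of the piece \<open>k 0\<close>; that neighbour does not meet \<open>A\<close>, so these pieces lie outside \<open>A'\<close>.  Hence \<open>A'\<close> is
  contained in the piece \<open>k 1\<close>, and the argument repeats.\<close>
lemma clopen_shrinks:
  assumes "\<And>i. x i \<in> F \<and> x i \<notin> vertices \<and> k i \<in> {1..n} \<and> x i = f (k i) (x (Suc i))"
    and "openin (top_of_set (F - {x 0})) A" "closedin (top_of_set (F - {x 0})) A"
    and "A \<subseteq> piece (k 0)" "a \<in> A"
  shows "dist a (x 0) \<le> c_max ^ m * diameter F"
  using assms
proof (induction m arbitrary: x k A a)
  case 0
  have "a \<in> F" using 0(1)[of 0] 0(4,5) piece_subset[of "k 0"] by auto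
  then show ?case using dist_le_diameter[of a "x 0"] conjunct1[OF 0(1)[of 0]] by simp
next
  case (Suc m)
  note path = Suc.prems(1)
  define x1 k0 k1 where "x1 = x (Suc 0)" and "k0 = k 0" and "k1 = k (Suc 0)"
  have x1: "x1 \<in> F" "x1 \<notin> vertices" "x1 \<in> piece k1" "k1 \<in> {1..n}"
    and x0: "x 0 = f k0 x1" "k0 \<in> {1..n}" "x 0 \<in> piece k0" "x 0 \<notin> vertices"
    using path[of 0] path[of 1] path[of 2] by (auto simp: x1_def k0_def k1_def numeral_2_eq_2)
  define A' where "A' = (F - {x1}) \<inter> f k0 -` A"
  have maps: "f k0 \<in> F - {x1} \<rightarrow> F - {x 0}"
    using x0 piece_subset[OF x0(2)] inj_f[OF x0(2)] by (auto dest: injD)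
  have cont: "continuous_on (F - {x1}) (f k0)"
    using similarity_continuous sim x0 by blast
  have A': "openin (top_of_set (F - {x1})) A'" "closedin (top_of_set (F - {x1})) A'"
    unfolding A'_def
    using continuous_openin_preimage[OF cont maps] continuous_closedin_preimage_gen[OF cont _ Suc.prems(3)]
       Suc.prems(2) maps by auto
  have one_side: "A' \<subseteq> piece k1"
  proof (rule ccontr)
    assume "\<not> A' \<subseteq> piece k1"
    then obtain y where "y \<in> A'" "y \<notin> piece k1" by blast
    let ?Y = "\<Union>i\<in>{1..n} - {k1}. piece i"
    have "y \<in> F" using \<open>y \<in> A'\<close> by (simp add: A'_def)
    then have "?Y \<inter> A' \<noteq> {}"
      using \<open>y \<in> A'\<close> \<open>y \<notin> piece k1\<close> in_some_piece[of y] by blast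
    moreover have "?Y \<subseteq> F - {x1}"
      using other_pieces_subset x1 by simp
    ultimately have Y: "?Y \<subseteq> A'"
      using connected_subset_clopen[OF connected_other_pieces[OF x1(4)] _ A'] by blast
    obtain j q i where q: "j \<in> {1..n} - {k1}" "q \<in> piece j"
      "i \<in> {1..n} - {k0}" "f k0 q \<in> piece i"
      using boundary_not_in_one_piece[OF x0(2), of k1] by blast
    then have "q \<in> A'" using Y by blast
    then have "f k0 q \<in> A" by (simp add: A'_def)
    moreover have "x 0 \<notin> piece i"
      using not_in_other_piece[OF x0(2) x0(3,4) q(3)] .
    then have "piece i \<subseteq> F - {x 0}"
      using piece_subset[of i] q(3) by blast
    ultimately have "piece i \<subseteq> A"
      using connected_subset_clopen[OF connected_piece _ Suc.prems(2,3), of i] q(3,4) by blast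
    then have "piece i \<subseteq> piece k0"
      using Suc.prems(4) by (simp add: k0_def)
    moreover obtain u v where "u \<in> piece i" "v \<in> piece i" "u \<noteq> v"
      using piece_two_points[of i] q(3) by blast
    ultimately show False
      using meeting_point_unique[of i k0 u v] q(3) x0(2) by blast
  qed
  obtain a' where a': "a' \<in> F" "a = f k0 a'"
    using Suc.prems(4,5) by (auto simp: k0_def)
  have "x 0 \<notin> A"
    using Suc.prems(2) openin_imp_subset by fastforce
  then have "a' \<in> A'"
    using a' x0 Suc.prems(5) by (auto simp: A'_def)
  have "dist a' x1 \<le> c_max ^ m * diameter F"
    unfolding x1_def
  proof (rule Suc.IH[of "\<lambda>i. x (Suc i)" "\<lambda>i. k (Suc i)" A'])
    show "A' \<subseteq> piece (k (Suc 0))" using one_side by (simp add: k1_def)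
    show "x (Suc i) \<in> F \<and> x (Suc i) \<notin> vertices \<and> k (Suc i) \<in> {1..n} \<and>
        x (Suc i) = f (k (Suc i)) (x (Suc (Suc i)))" for i
      by (rule path)
    show "openin (top_of_set (F - {x (Suc 0)})) A'" "closedin (top_of_set (F - {x (Suc 0)})) A'"
      using A' by (simp_all only: x1_def)
  qed (rule \<open>a' \<in> A'\<close>)
  then have "c_max * dist a' x1 \<le> c_max ^ Suc m * diameter F"
    using c_max_bounds by simp
  then show ?case
    using dist_f_le[OF x0(2), of a' x1] a' x0(1) by simp
qed

text \<open>The pieces other than the first one on the path form a connected set, so one side of a separation avoids them
  and is squeezed as above; it would consist of points at distance 0 from \<open>x 0\<close>.\<close>
lemma cut_path_hits_vertex:
  assumes path: "\<And>i. x i \<in> F \<and> k i \<in> {1..n} \<and> x i = f (k i) (x (Suc i))"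
    and cut: "\<not> connected (F - {x 0})"
  shows "\<exists>i. x i \<in> vertices"
proof (rule ccontr)
  assume no: "\<not> ?thesis"
  let ?X = "F - {x 0}" and ?Y = "\<Union>i\<in>{1..n} - {k 0}. piece i"
  obtain A where A: "openin (top_of_set ?X) A" "closedin (top_of_set ?X) A" "A \<noteq> {}" "A \<noteq> ?X"
    using cut unfolding connected_clopen by blast
  have compl: "openin (top_of_set ?X) (?X - A)" "closedin (top_of_set ?X) (?X - A)"
    using A by (auto simp: openin_diff closedin_diff)
  have "x 0 \<in> piece (k 0)" using path[of 0] path[of 1] by auto
  then have "?Y \<subseteq> ?X"
    using path[of 0] no by (intro other_pieces_subset) blast+
  have rest: "?X - ?Y \<subseteq> piece (k 0)"
    using in_some_piece by blast
  have "\<exists>B. openin (top_of_set ?X) B \<and> closedin (top_of_set ?X) B \<and> B \<noteq> {} \<and> B \<inter> ?Y = {}"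
  proof (cases "A \<inter> ?Y = {}")
    case True
    then show ?thesis using A by blast
  next
    case False
    then have "?Y \<subseteq> A"
      using connected_subset_clopen[OF connected_other_pieces \<open>?Y \<subseteq> ?X\<close> A(1,2)] path[of 0] by blast
    moreover have "A \<subseteq> ?X" using A(1) openin_imp_subset by blast
    ultimately show ?thesis using compl A(4) by blast
  qed
  then obtain B where B: "openin (top_of_set ?X) B" "closedin (top_of_set ?X) B" "B \<noteq> {}" "B \<inter> ?Y = {}"
    by blast
  have "B \<subseteq> ?X" using B(1) openin_imp_subset by blast
  then have "B \<subseteq> piece (k 0)" using rest B(4) by blast
  obtain b where b: "b \<in> B" using B(3) by blast
  have "dist b (x 0) \<le> c_max ^ m * diameter F" for m
  proof (rule clopen_shrinks[where x = x and k = k, OF _ B(1,2) \<open>B \<subseteq> piece (k 0)\<close> b])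
    show "x i \<in> F \<and> x i \<notin> vertices \<and> k i \<in> {1..n} \<and> x i = f (k i) (x (Suc i))" for i
      using path[of i] no by blast
  qed
  moreover have "(\<lambda>m. c_max ^ m * diameter F) \<longlonglongrightarrow> 0"
    using c_max_bounds by (intro tendsto_mult_left_zero LIMSEQ_power_zero) auto
  ultimately have "dist b (x 0) \<le> 0"
    by (intro LIMSEQ_le_const) auto
  then show False using b \<open>B \<subseteq> ?X\<close> by auto
qed

section \<open>Copies of the necklace that meet in one point\<close>

text \<open>The first piece meets the union of the others in a finite set containing two distinct points.\<close>
lemma F_has_hole: "\<exists>U. hole F U"
proof -
  have one: "1 \<in> {1..n}" and two: "2 \<in> {1..n}" and last: "n \<in> {1..n}"
    using n_ge_3 by auto
  let ?Y = "\<Union>k\<in>{1..n} - {1}. piece k"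
  have "\<not> connected (piece 1 \<inter> ?Y)"
  proof
    assume "connected (piece 1 \<inter> ?Y)"
    moreover have "piece 1 \<inter> ?Y \<subseteq> vertices"
    proof
      fix w assume "w \<in> piece 1 \<inter> ?Y"
      then obtain k where "k \<in> {1..n} - {1}" "w \<in> piece 1 \<inter> piece k" by blast
      then show "w \<in> vertices"
        unfolding vertices_def using one by (intro UN_I[of 1] UN_I[of k])
    qed
    then have "finite (piece 1 \<inter> ?Y)"
      using finite_vertices by (rule finite_subset)
    moreover have "is_singleton (piece 1 \<inter> piece 2)" "is_singleton (piece 1 \<inter> piece n)"
      using n_ge_3 by (auto intro!: pieces_meet)
    then obtain u v where u: "u \<in> piece 1" "u \<in> piece 2" and v: "v \<in> piece 1" "v \<in> piece n"
      unfolding is_singleton_def by blast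
    moreover have "2 \<in> {1..n} - {1}" "n \<in> {1..n} - {1}"
      using n_ge_3 by auto
    then have "u \<in> piece 1 \<inter> ?Y" "v \<in> piece 1 \<inter> ?Y"
      using u v by blast+
    ultimately have "u = v"
      using connected_finite_iff_sing by (metis empty_iff singletonD)
    then show False
      using no_triple_point[OF one two last] u v n_ge_3 by auto
  qed
  moreover have "compact ?Y"
    using compact_piece by (intro compact_UN) auto
  ultimately have "\<exists>U. hole (piece 1 \<union> ?Y) U"
    using compact_piece[OF one] connected_piece[OF one] connected_other_pieces[OF one]
    by (intro ex_hole)
  moreover have "piece 1 \<union> ?Y = F"
    using one by (subst F_eq) auto
  ultimately show ?thesis by simp
qed

text \<open>A connected set that meets the hole of \<open>h ` F\<close> without meeting \<open>h ` F\<close> lies in the hole, and the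
  hole is no wider than \<open>h ` F\<close>.\<close>
lemma copy_in_hole_not_larger:
  assumes g: "similarity r g" and h: "similarity s h" and U: "hole (h ` F) U"
    and disj: "g ` F \<inter> h ` F = {}" and meet: "g ` F \<inter> U \<noteq> {}"
  shows "r \<le> s"
proof -
  have "connected (g ` F)"
    using connected_F connected_continuous_image similarity_continuous[OF g] by blast
  then have sub: "g ` F \<subseteq> U"
    using connected_subset_hole[OF U _ disj meet] by simp
  obtain x y where xy: "x \<in> F" "y \<in> F" "dist x y = diameter F"
    using diameter_compact_attained[OF compact_F F_nonempty] by blast
  obtain u v where uv: "u \<in> F" "v \<in> F" "u \<noteq> v"
    using F_two_points by blast
  then have "0 < dist u v" by simp
  also have "\<dots> \<le> diameter F" using dist_le_diameter uv by blast
  finally have pos: "diameter F > 0" .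
  then have "g x \<noteq> g y"
    using similarity_inj[OF g] xy by (metis dist_self injD less_irrefl)
  then obtain a b where ab: "a \<in> h ` F" "b \<in> h ` F" "dist (g x) (g y) \<le> dist a b"
    using hole_dist_le[OF U, of "g x" "g y"] sub xy by blast
  then obtain a' b' where "a' \<in> F" "b' \<in> F" "a = h a'" "b = h b'"
    by blast
  then have "dist a b \<le> s * diameter F"
    using similarity_dist[OF h] similarity_pos[OF h] dist_le_diameter by simp
  then have "r * diameter F \<le> s * diameter F"
    using ab(3) similarity_dist[OF g, of x y] xy(3) by simp
  then show ?thesis using pos by simp
qed

lemma misses_some_piece: "\<exists>k\<in>{1..n}. x \<notin> piece k"
proof (rule ccontr)
  assume no: "\<not> ?thesis"
  have "1 \<in> {1..n}" "2 \<in> {1..n}" "3 \<in> {1..n}" using n_ge_3 by auto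
  then show False using no no_triple_point[of 1 2 3 x] by auto
qed

definition c_min :: real where "c_min = Min (c ` {1..n})"

lemma c_min_le: "k \<in> {1..n} \<Longrightarrow> c_min \<le> c k"
  by (simp add: c_min_def)

lemma c_min_pos: "0 < c_min"
  using similarity_pos[OF sim] n_ge_3 unfolding c_min_def by (subst Min_gr_iff) auto

text \<open>Compare two members of the family that are almost equal, and in them the subcopies with a common
  address \<open>a, b\<close>.  Two letters suffice to avoid \<open>z\<close> in both: \<open>a\<close> is chosen for the first
  copy and \<open>b\<close> for the second.\<close>
lemma no_pencil_of_copies:
  assumes g: "\<And>m::nat. similarity (r m) (g m)"
    and bounds: "\<And>m. k \<le> r m" "\<And>m. r m \<le> R" and "k > 0"
    and z: "\<And>m. z \<in> g m ` F"
    and meet: "\<And>m l. m \<noteq> l \<Longrightarrow> g m ` F \<inter> g l ` F \<subseteq> {z}"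
  shows False
proof -
  obtain U where U: "hole F U" using F_has_hole by blast
  then obtain p where "p \<in> U" by (auto simp: hole_def)
  then obtain e where e: "e > 0" "ball p e \<subseteq> U"
    using U by (metis hole_def open_contains_ball)
  define G where "G = (\<lambda>m (a, b). g m \<circ> (f a \<circ> f b))"
  let ?I = "{1..n} \<times> {1..n}"
  \<comment> \<open>\<open>e1\<close> is a lower bound for the radius of the image of \<open>ball p e\<close> under any \<open>G m (a, b)\<close>; for two
    members whose ratios differ by less than \<open>e2\<close>, each whole copy is larger than any second-level
    subcopy of the other.\<close>
  define e1 where "e1 = k * (c_min * c_min) * e"
  define e2 where "e2 = k * (1 - c_max * c_max)"
  have "e1 > 0" using \<open>k > 0\<close> e c_min_pos by (simp add: e1_def)
  have cc: "c_max * c_max < 1" using c_max_bounds mult_strict_mono[of c_max 1 c_max 1] by simp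
  then have "e2 > 0" using \<open>k > 0\<close> by (simp add: e2_def)
  have simG: "similarity (r m * (c a * c b)) (G m (a, b))" if "a \<in> {1..n}" "b \<in> {1..n}" for m a b
    unfolding G_def split using that by (intro similarity_comp g sim)
  have bd: "bounded (range (\<lambda>m. G m i p))" if i: "i \<in> ?I" for i
  proof -
    obtain a b where ab: "i = (a, b)" "a \<in> {1..n}" "b \<in> {1..n}" using i by blast
    define q where "q = f a (f b p)"
    obtain B where B: "\<And>y. y \<in> F \<Longrightarrow> dist q y \<le> B"
      using compact_imp_bounded[OF compact_F] bounded_any_center[of F q] by blast
    have "dist z (G m i p) \<le> R * B" for m
    proof -
      obtain y where y: "y \<in> F" "z = g m y" using z[of m] by blast
      have "dist z (G m i p) = r m * dist q y"
        using similarity_dist[OF g, of m y q] y ab by (simp add: G_def q_def dist_commute)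
      also have "\<dots> \<le> R * B"
        using B[OF y(1)] bounds(2)[of m] similarity_pos[OF g, of m]
        by (intro mult_mono) (auto intro: less_imp_le less_le_trans)
      finally show ?thesis .
    qed
    then show ?thesis by (auto simp: bounded_def)
  qed
  obtain S where S: "infinite S" "\<forall>m\<in>S. \<forall>l\<in>S. \<forall>i\<in>?I. dist (G m i p) (G l i p) < e1"
    using infinite_subset_pairwise_close[of ?I UNIV "\<lambda>m i. G m i p" e1] bd \<open>e1 > 0\<close> by auto
  have "bounded (range r)"
    using bounds by (intro bounded_subset[OF bounded_closed_interval, of _ k R]) auto
  then obtain T where T: "T \<subseteq> S" "infinite T" "\<forall>m\<in>T. \<forall>l\<in>T. dist (r m) (r l) < e2"
    using infinite_subset_pairwise_close[of "{()}" S "\<lambda>m _. r m" e2] S(1) \<open>e2 > 0\<close> by auto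
  obtain m where m: "m \<in> T" using infinite_imp_nonempty[OF T(2)] by blast
  obtain l where l: "l \<in> T" "l \<noteq> m"
    using infinite_imp_nonempty[OF infinite_remove[OF T(2), of m]] by blast
  obtain y where y: "y \<in> F" "z = g l y" using z by blast
  obtain y' where y': "y' \<in> F" "z = g m y'" using z by blast
  \<comment> \<open>\<open>a\<close> keeps \<open>z\<close> out of the subcopy of the \<open>l\<close>-th copy, \<open>b\<close> out of that of the \<open>m\<close>-th.\<close>
  obtain a where a: "a \<in> {1..n}" "y \<notin> piece a" using misses_some_piece by blast
  obtain b where b: "b \<in> {1..n}" "inv (f a) y' \<notin> piece b" using misses_some_piece by blast
  have sub: "G j (a, b) ` F \<subseteq> g j ` F" for j
    using piece_subset[OF a(1)] piece_subset[OF b(1)] by (fastforce simp: G_def)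
  have zl: "z \<notin> G l (a, b) ` F"
  proof
    assume "z \<in> G l (a, b) ` F"
    then obtain w where "w \<in> F" "g l y = g l (f a (f b w))"
      using y by (auto simp: G_def)
    then have "y = f a (f b w)" using similarity_inj[OF g] by (metis injD)
    moreover have "f b w \<in> F" using piece_subset[OF b(1)] \<open>w \<in> F\<close> by blast
    ultimately show False using a(2) by blast
  qed
  have zm: "z \<notin> G m (a, b) ` F"
  proof
    assume "z \<in> G m (a, b) ` F"
    then obtain w where "w \<in> F" "g m y' = g m (f a (f b w))"
      using y' by (auto simp: G_def)
    then have "y' = f a (f b w)" using similarity_inj[OF g] by (metis injD)
    then have "inv (f a) y' = f b w" using inj_f[OF a(1)] by simp
    then show False using b(2) \<open>w \<in> F\<close> by blast
  qed
  have disj: "g j ` F \<inter> G i (a, b) ` F = {}" if "j \<noteq> i" "z \<notin> G i (a, b) ` F" for i j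
    using meet[OF that(1)] that(2) sub[of i] by blast
  have holes: "hole (G j (a, b) ` F) (G j (a, b) ` U)" for j
    using hole_similarity_image[OF simG[OF a(1) b(1)] U] .
  have conn: "connected (G j (a, b) ` F)" for j
    using connected_F connected_continuous_image similarity_continuous[OF simG[OF a(1) b(1)]] by blast
  \<comment> \<open>The holes overlap because the two images of \<open>p\<close> are closer than the radius of the image of \<open>ball p e\<close>.\<close>
  have "G l (a, b) ` U \<inter> G m (a, b) ` U \<noteq> {}"
  proof -
    let ?q = "G m (a, b) p"
    obtain w where w: "?q = G l (a, b) w"
      using similarity_surj[OF simG[OF a(1) b(1)], of l] by (metis surjD)
    have "k * (c_min * c_min) \<le> r l * (c a * c b)"
      using bounds(1)[of l] c_min_le[OF a(1)] c_min_le[OF b(1)] c_min_pos \<open>k > 0\<close>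
      by (intro mult_mono) auto
    then have "e1 \<le> r l * (c a * c b) * e"
      unfolding e1_def using e(1) by (intro mult_right_mono) auto
    moreover have "dist (G l (a, b) p) ?q < e1"
      using S(2) T(1) m l(1) a(1) b(1) by blast
    ultimately have "r l * (c a * c b) * dist p w < r l * (c a * c b) * e"
      using similarity_dist[OF simG[OF a(1) b(1)], of l p w] w by simp
    then have "dist p w < e"
      using similarity_pos[OF simG[OF a(1) b(1)], of l] by (simp only: mult_less_cancel_left_pos)
    then have "w \<in> U" using e(2) by auto
    then show ?thesis using w \<open>p \<in> U\<close> by blast
  qed
  moreover have "G l (a, b) ` F \<inter> G m (a, b) ` F = {}"
    using disj[OF l(2) zm] sub[of l] by blast
  ultimately consider "G l (a, b) ` F \<subseteq> G m (a, b) ` U" | "G m (a, b) ` F \<subseteq> G l (a, b) ` U"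
    using nested_holes[OF holes holes conn conn] by blast
  then obtain i j where ij: "i \<in> T" "j \<in> T" "r j \<le> r i * (c a * c b)"
  proof cases
    case 1
    then have "g l ` F \<inter> G m (a, b) ` U \<noteq> {}" using sub[of l] F_nonempty by blast
    then have "r l \<le> r m * (c a * c b)"
      using copy_in_hole_not_larger[OF g simG[OF a(1) b(1)] holes disj[OF l(2) zm]] by blast
    then show ?thesis using that l(1) m by blast
  next
    case 2
    then have "g m ` F \<inter> G l (a, b) ` U \<noteq> {}" using sub[of m] F_nonempty by blast
    then have "r m \<le> r l * (c a * c b)"
      using copy_in_hole_not_larger[OF g simG[OF a(1) b(1)] holes disj[OF l(2)[symmetric] zl]] by blast
    then show ?thesis using that l(1) m by blast
  qed
  have "c a * c b \<le> c_max * c_max"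
    using ratio_le_max[OF a(1)] ratio_le_max[OF b(1)] similarity_pos[OF sim[OF b(1)]] c_max_bounds
    by (intro mult_mono) auto
  then have "r i * (c a * c b) \<le> r i * (c_max * c_max)"
    using similarity_pos[OF g, of i] by (intro mult_left_mono) auto
  then have "r i * (1 - c_max * c_max) \<le> r i - r j"
    using ij(3) by (simp add: algebra_simps)
  also have "\<dots> < k * (1 - c_max * c_max)"
    using abs_ge_self[of "r i - r j"] T(3)[rule_format, OF ij(1,2)]
    by (simp add: dist_real_def e2_def)
  also have "\<dots> \<le> r i * (1 - c_max * c_max)"
    using bounds(1)[of i] cc by (intro mult_right_mono) auto
  finally show False by simp
qed

text \<open>Follow an address of \<open>y\<close> and stop at the first ratio that is at most \<open>d\<close>; the last letter has lost
  at most a factor \<open>c_min\<close>.\<close>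
lemma copy_of_given_size:
  assumes "y \<in> F" "0 < d" "d \<le> 1"
  shows "\<exists>r h. similarity r h \<and> c_min * d \<le> r \<and> r \<le> d \<and> y \<in> h ` F \<and> h ` F \<subseteq> F"
proof -
  have c_min_le_1: "c_min \<le> 1"
    using c_min_le[of 1] ratio_less[of 1] n_ge_3 by auto
  have small: "\<exists>r h. similarity r h \<and> c_min * d \<le> r \<and> r \<le> d \<and> y \<in> h ` F \<and> h ` F \<subseteq> F"
    if "y \<in> F" "c_max ^ N \<le> d" "d \<le> 1" for N
    using that
  proof (induction N arbitrary: d y)
    case 0
    then show ?case
      using c_min_le_1 by (intro exI[of _ 1] exI[of _ id] conjI similarity_id) auto
  next
    case (Suc N)
    have "d > 0" using Suc.prems(2) c_max_bounds by (meson less_le_trans zero_less_power)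
    obtain k y' where k: "k \<in> {1..n}" "y' \<in> F" "y = f k y'"
      using in_some_piece[OF Suc.prems(1)] by blast
    show ?case
    proof (cases "c k \<le> d")
      case True
      have "c_min * d \<le> c_min * 1"
        using Suc.prems(3) c_min_pos by (intro mult_left_mono) auto
      then have "c_min * d \<le> c k" using c_min_le[OF k(1)] by simp
      then show ?thesis
        using True sim[OF k(1)] k piece_subset[OF k(1)] by blast
    next
      case False
      have ck: "0 < c k" "c k \<le> c_max" using similarity_pos[OF sim] ratio_le_max k(1) by auto
      have "c_max ^ N * c k \<le> c_max ^ Suc N"
        using ck c_max_bounds by (simp add: mult_left_mono mult.commute)
      also have "\<dots> \<le> d" by (rule Suc.prems(2))
      finally have "c_max ^ N \<le> d / c k"
        using ck by (simp add: pos_le_divide_eq)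
      moreover have "d / c k \<le> 1" using False ck by simp
      ultimately obtain r h where h: "similarity r h" "c_min * (d / c k) \<le> r" "r \<le> d / c k"
        "y' \<in> h ` F" "h ` F \<subseteq> F"
        using Suc.IH[OF k(2)] by blast
      have "similarity (c k * r) (f k \<circ> h)"
        by (intro similarity_comp sim k h)
      moreover have "c_min * d \<le> c k * r" "c k * r \<le> d"
        using h(2,3) ck by (simp_all add: field_simps)
      moreover have "y \<in> (f k \<circ> h) ` F" using k h(4) by auto
      moreover have "(f k \<circ> h) ` F \<subseteq> F" using h(5) piece_subset[OF k(1)] by fastforce
      ultimately show ?thesis by blast
    qed
  qed
  obtain N where "c_max ^ N < d"
    using real_arch_pow_inv[OF assms(2)] c_max_bounds by blast
  then show ?thesis using small[of N] assms by simp
qed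

text \<open>For \<open>m < l\<close> the map \<open>h ^^ (l - m)\<close> sends the piece \<open>b\<close> into the piece \<open>a\<close>, which
  meets the piece \<open>b\<close> only in \<open>z\<close>.  So the pullbacks of the piece \<open>b\<close> by the powers of \<open>h\<close>
  meet only in \<open>z\<close>.  They grow without bound, but each contains a copy of \<open>F\<close> through \<open>z\<close> of
  scale comparable to 1.\<close>
lemma no_fixed_vertex:
  assumes h: "similarity s h" "s < 1" "h ` F \<subseteq> piece a" "h z = z"
    and ab: "a \<in> {1..n}" "b \<in> {1..n}" "a \<noteq> b" "z \<in> piece a" "z \<in> piece b"
  shows False
proof -
  obtain y where y: "y \<in> F" "z = f b y" using ab(5) by blast
  have s: "0 < s" using similarity_pos h by blast
  have "\<exists>r t. similarity r t \<and> c_min * s ^ m \<le> r \<and> r \<le> s ^ m \<and> y \<in> t ` F \<and> t ` F \<subseteq> F" for m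
    using copy_of_given_size[OF y(1)] s h(2) by (simp add: power_le_one)
  then obtain r t where t: "\<And>m. similarity (r m) (t m)" "\<And>m. c_min * s ^ m \<le> r m"
    "\<And>m. r m \<le> s ^ m" "\<And>m. y \<in> t m ` F" "\<And>m. t m ` F \<subseteq> F"
    by metis
  define E where "E = (\<lambda>m. inv (h ^^ m))"
  have simE: "similarity (inverse (s ^ m)) (E m)" for m
    unfolding E_def by (rule similarity_inv[OF similarity_funpow[OF h(1)]])
  have hE: "(h ^^ m) (E m w) = w" for m w
    unfolding E_def by (rule surj_f_inv_f[OF similarity_surj[OF similarity_funpow[OF h(1)]]])
  have Ez: "E m z = z" for m
  proof -
    have "(h ^^ m) z = z" using h(4) by (induction m) auto
    then show ?thesis
      unfolding E_def using similarity_inj[OF similarity_funpow[OF h(1)]] by (metis inv_f_f)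
  qed
  show False
  proof (rule no_pencil_of_copies[where g = "\<lambda>m. E m \<circ> (f b \<circ> t m)" and z = z
        and r = "\<lambda>m. inverse (s ^ m) * (c b * r m)" and k = "c b * c_min" and R = "c b"])
    show "similarity (inverse (s ^ m) * (c b * r m)) (E m \<circ> (f b \<circ> t m))" for m
      by (intro similarity_comp simE sim ab t)
    have cb: "0 < c b" using similarity_pos[OF sim[OF ab(2)]] .
    then show "0 < c b * c_min" using c_min_pos by simp
    show "c b * c_min \<le> inverse (s ^ m) * (c b * r m)" "inverse (s ^ m) * (c b * r m) \<le> c b" for m
      using t(2,3)[of m] s cb by (simp_all add: field_simps power_inverse)
    show "z \<in> (E m \<circ> (f b \<circ> t m)) ` F" for m
    proof -
      obtain u where "u \<in> F" "y = t m u" using t(4) by blast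
      then show ?thesis using y(2) Ez[of m] by (auto intro!: image_eqI[of _ _ u])
    qed
    have sub: "(E m \<circ> (f b \<circ> t m)) ` F \<subseteq> E m ` piece b" for m
      using t(5)[of m] by fastforce
    have "E m ` piece b \<inter> E (m + Suc d) ` piece b \<subseteq> {z}" for m d
    proof
      fix w assume "w \<in> E m ` piece b \<inter> E (m + Suc d) ` piece b"
      then obtain u v where uv: "u \<in> piece b" "v \<in> piece b" "w = E m u" "w = E (m + Suc d) v"
        by blast
      have "v = (h ^^ (Suc d + m)) w"
        using uv(4) hE[of "m + Suc d" v] by (simp only: add.commute)
      also have "\<dots> = (h ^^ Suc d) u"
        using uv(3) hE[of m u] by (simp only: funpow_add comp_apply)
      finally have v: "(h ^^ Suc d) u = v" by simp
      have "(h ^^ i) u' \<in> F" if "u' \<in> F" for i u'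
        using that h(3) piece_subset[OF ab(1)] by (induction i) auto
      then have "(h ^^ d) u \<in> F"
        using uv(1) piece_subset[OF ab(2)] by blast
      then have "(h ^^ Suc d) u \<in> piece a"
        using h(3) by auto
      then have "v = z"
        using v meeting_point_unique[OF ab(1,2,3)] ab(4,5) uv(2) by metis
      then show "w \<in> {z}" using uv(4) Ez by simp
    qed
    note * = this
    show "(E m \<circ> (f b \<circ> t m)) ` F \<inter> (E l \<circ> (f b \<circ> t l)) ` F \<subseteq> {z}" if "m \<noteq> l" for m l
    proof -
      have "E m ` piece b \<inter> E l ` piece b \<subseteq> {z}"
      proof (cases "m < l")
        case True
        then show ?thesis using *[of m "l - Suc m"] by simp
      next
        case False
        then show ?thesis using *[of l "m - Suc l"] that by (simp add: Int_commute)
      qed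
      then show ?thesis by (rule order_trans[OF Int_mono[OF sub sub]])
    qed
  qed
qed

text \<open>The composition of the maps along a section of a path.\<close>
lemma address_map:
  assumes "\<And>i. x i \<in> F \<and> k i \<in> {1..n} \<and> x i = f (k i) (x (Suc i))"
  shows "\<exists>h s. similarity s h \<and> s < 1 \<and> h ` F \<subseteq> piece (k m) \<and> h (x (m + Suc d)) = x m"
proof (induction d)
  case 0
  have "similarity (c (k m)) (f (k m)) \<and> c (k m) < 1"
    using assms[of m] sim ratio_less by blast
  moreover have "f (k m) (x (m + Suc 0)) = x m"
    using assms[of m] by simp
  ultimately show ?case by blast
next
  case (Suc d)
  then obtain h s where h: "similarity s h" "s < 1" "h ` F \<subseteq> piece (k m)" "h (x (m + Suc d)) = x m"
    by blast
  define j where "j = k (m + Suc d)"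
  have j: "j \<in> {1..n}" "x (m + Suc d) = f j (x (m + Suc (Suc d)))"
    using assms[of "m + Suc d"] by (simp_all add: j_def)
  have "similarity (s * c j) (h \<circ> f j)"
    by (intro similarity_comp h sim j)
  moreover have "s * c j < 1"
    using h(2) ratio_less[OF j(1)] similarity_pos[OF h(1)] similarity_pos[OF sim[OF j(1)]]
      mult_strict_mono[of s 1 "c j" 1] by simp
  moreover have "(h \<circ> f j) ` F \<subseteq> piece (k m)"
    using h(3) piece_subset[OF j(1)] by fastforce
  moreover have "(h \<circ> f j) (x (m + Suc (Suc d))) = x m"
    using h(4) j(2) by simp
  ultimately show ?case by blast
qed

lemma no_cut_point: "connected (F - {x})"
proof (rule ccontr)
  assume cut: "\<not> connected (F - {x})"
  have "x \<in> F"
    using cut connected_F by (cases "x \<in> F") auto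
  have "\<exists>y. \<forall>i. (y i \<in> F \<and> \<not> connected (F - {y i})) \<and>
      (\<exists>k\<in>{1..n}. y i = f k (y (Suc i)))"
  proof (rule dependent_nat_choice)
    show "\<exists>y. y \<in> F \<and> \<not> connected (F - {y})"
      using \<open>x \<in> F\<close> cut by blast
    show "\<exists>y'. (y' \<in> F \<and> \<not> connected (F - {y'})) \<and> (\<exists>k\<in>{1..n}. y = f k y')"
      if "y \<in> F \<and> \<not> connected (F - {y})" for y and i :: nat
      using cut_point_descends[of y] that by blast
  qed
  then obtain y where y: "\<And>i. y i \<in> F" "\<And>i. \<not> connected (F - {y i})"
    "\<And>i. \<exists>k\<in>{1..n}. y i = f k (y (Suc i))"
    by blast
  then obtain k where k: "\<And>i. k i \<in> {1..n}" "\<And>i. y i = f (k i) (y (Suc i))"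
    by metis
  have path: "y i \<in> F \<and> k i \<in> {1..n} \<and> y i = f (k i) (y (Suc i))" for i
    using y(1) k by blast
  have "\<exists>i\<ge>N. y i \<in> vertices" for N
    using cut_path_hits_vertex[of "\<lambda>i. y (N + i)" "\<lambda>i. k (N + i)"] path y(2)
    by (metis add_0_right add_Suc_right le_add1)
  then have "infinite {i. y i \<in> vertices}"
    by (auto simp: infinite_nat_iff_unbounded_le)
  moreover have "finite (y ` {i. y i \<in> vertices})"
    using finite_vertices by (rule finite_subset[rotated]) auto
  ultimately obtain i where i: "y i \<in> vertices" "infinite {j \<in> {i. y i \<in> vertices}. y j = y i}"
    using pigeonhole_infinite by blast
  from i(2) have "\<exists>j>i. j \<in> {j \<in> {i. y i \<in> vertices}. y j = y i}"
    by (simp only: infinite_nat_iff_unbounded)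
  then obtain j where "j > i" "y j = y i" by blast
  then obtain h s where h: "similarity s h" "s < 1" "h ` F \<subseteq> piece (k i)" "h (y i) = y i"
  proof -
    have "\<exists>h s. similarity s h \<and> s < 1 \<and> h ` F \<subseteq> piece (k i) \<and> h (y (i + Suc (j - Suc i))) = y i"
      using path by (rule address_map)
    moreover have "i + Suc (j - Suc i) = j" using \<open>j > i\<close> by simp
    ultimately show ?thesis using that \<open>y j = y i\<close> by metis
  qed
  have "y i \<in> piece (k i)" using k(2)[of i] y(1) by blast
  moreover obtain b where "b \<in> {1..n}" "k i \<noteq> b" "y i \<in> piece b"
    using i(1) unfolding vertices_iff by metis
  ultimately show False
    using no_fixed_vertex[OF h k(1)] by blast
qed

end

theorem corollary1p1:
  fixes n :: nat and f :: "nat \<Rightarrow> real^2 \<Rightarrow> real^2" and F :: "(real^2) set"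
  assumes "self_similar_necklace n f F"
    and "stable_necklace n f F"
  shows "\<not> (\<exists>x. cut_point F x)"
proof -
  have neck: "necklace n f F" and simil: "\<And>k. k \<in> {1..n} \<Longrightarrow> similitude (f k)"
    using assms(1) by (auto simp: self_similar_necklace_def)
  have "\<exists>r. similarity r (f k) \<and> r < 1" if "k \<in> {1..n}" for k
  proof -
    have "\<exists>g. homeomorphism UNIV UNIV (f k) g"
      using neck that unfolding necklace_def by blast
    then have "surj (f k)" by (auto simp: homeomorphism_def)
    then show ?thesis
      using similarity_of_similitude[OF simil[OF that]] by blast
  qed
  then obtain c where "\<And>k. k \<in> {1..n} \<Longrightarrow> similarity (c k) (f k) \<and> c k < 1"
    by metis
  then interpret stable_similar_necklace n f F c
    using neck assms(2) by unfold_locales auto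
  show ?thesis
    using no_cut_point by (simp add: cut_point_def)
qed

end
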